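(* Let $\Lambda_n=\mathrm{diag}(\lambda_1,\dots,\lambda_n)\in \mathrm{Mat}(n,\mathbb{C})$ be a diagonal matrix whose eigenvalues $\lambda_1,\dots,\lambda_n$ are pairwise distinct and all nonzero, let $A_n=(a_{km})_{k,m=1}^n\in \mathrm{Mat}(n,\mathbb{C})$ be an arbitrary matrix, and let $\Gamma_{A_n}$ be the directed graph associated with the support of $A_n$. Then: (i) the family $(\Lambda_n,A_n)$ is irreducible if and only if the graph $\Gamma_{A_n}$ is strongly connected; (ii) the family $(\Lambda_n,A_n)$ is Schur irreducible if and only if the graph $\Gamma_{A_n}$ is weakly connected; (iii) the family $(\Lambda_n,A_n)$ is indecomposable if and only if it is Schur irreducible.
   Context: $\mathrm{Mat}(n,\mathbb{C})$ is the algebra of complex $n\times n$ matrices, acting on $\mathbb{C}^n$. The support of $A_n$ is $\mathrm{Supp}(A_n)=\{(k,m)\in\{1,\dots,n\}^2\mid a_{km}\neq 0\}$. The directed graph $\Gamma_{A_n}$ has vertex set $\{1,\dots,n\}$ and an edge (arrow) from $k$ to $m$ exactly when $(k,m)\in\mathrm{Supp}(A_n)$. A directed graph is weakly connected if there is an undirected path between any pair of vertices, and strongly connected if there is a directed path from every vertex to every other vertex. A family of matrices in $\mathrm{Mat}(n,\mathbb{C})$ is called irreducible if no linear subspace of $\mathbb{C}^n$ other than $\{0\}$ and $\mathbb{C}^n$ is invariant under all matrices of the family; Schur irreducible if the only matrices in $\mathrm{Mat}(n,\mathbb{C})$ commuting with all matrices of the family are the scalar multiples of the identity; indecomposable if $\mathbb{C}^n$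 cannot be written as a direct sum $V_1\oplus V_2$ of two nonzero subspaces each invariant under all matrices of the family. *)

theory Defs
  imports "HOL-Analysis.Analysis" "Graph_Theory.Digraph_Component"
begin

text \<open>
  Matrices in $\mathrm{Mat}(n,\mathbb{C})$ have type \<open>complex^'n^'n\<close>, the finite type \<open>'n\<close> playing the
  role of $\{1,\dots,n\}$.  Linear subspaces over $\mathbb{C}$ are expressed by \<open>vec.subspace\<close>
  (closed under the scaling \<open>*s\<close> by complex scalars); the plain \<open>subspace\<close> of HOL-Analysis would mean
  \<^emph>\<open>real\<close> subspaces.
\<close>

definition diag_matrix :: "('n \<Rightarrow> 'a::zero) \<Rightarrow> 'a^'n^'n" where
  "diag_matrix l = (\<chi> i j. if i = j then l i else 0)"

definition matrix_supp :: "'a::zero^'n^'n \<Rightarrow> ('n \<times> 'n) set" where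
  "matrix_supp A = {(k, m). A $ k $ m \<noteq> 0}"

definition matrix_digraph :: "'a::zero^'n^'n \<Rightarrow> ('n, 'n \<times> 'n) pre_digraph" where
  "matrix_digraph A = with_proj \<lparr> pverts = UNIV, parcs = matrix_supp A \<rparr>"

text \<open>
  The library calls a digraph connected if its symmetrisation is strongly connected, which is weak
  connectedness.  The qualified name avoids the topological constant \<open>connected\<close>.
\<close>

abbreviation weakly_connected :: "('v, 'e) pre_digraph \<Rightarrow> bool" where
  "weakly_connected \<equiv> Digraph_Component.connected"

definition invariant_subspace :: "('a::field^'n^'n) set \<Rightarrow> ('a^'n) set \<Rightarrow> bool" where
  "invariant_subspace F V \<longleftrightarrow> vec.subspace V \<and> (\<forall>M\<in>F. \<forall>x\<in>V. M *v x \<in> V)"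

definition irreducible_family :: "('a::field^'n^'n) set \<Rightarrow> bool" where
  "irreducible_family F \<longleftrightarrow> (\<forall>V. invariant_subspace F V \<longrightarrow> V = {0} \<or> V = UNIV)"

text \<open>\<open>mat c\<close> is the scalar matrix $c I$.\<close>

definition schur_irreducible_family :: "('a::field^'n^'n) set \<Rightarrow> bool" where
  "schur_irreducible_family F \<longleftrightarrow>
    (\<forall>B. (\<forall>M\<in>F. B ** M = M ** B) \<longrightarrow> (\<exists>c. B = mat c))"

definition indecomposable_family :: "('a::field^'n^'n) set \<Rightarrow> bool" where
  "indecomposable_family F \<longleftrightarrow>
    \<not> (\<exists>V W. invariant_subspace F V \<and> invariant_subspace F W \<and> V \<noteq> {0} \<and> W \<noteq> {0} \<and>
          V \<inter> W = {0} \<and> {v + w | v w. v \<in> V \<and> w \<in> W} = UNIV)"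

end

theory Submission
  imports Defs
begin

text \<open>
  An invariant subspace of a diagonal matrix with distinct eigenvalues is spanned by the basis vectors
  it contains, so it is given by a set of indices; \<open>A\<close> preserves it iff this set is closed under
  predecessors in the graph.  Strong connectedness means that there are no nontrivial such sets,
  and weak connectedness that there is no nontrivial one whose complement is also closed.  Such a pair of
  complementary sets is the same as a direct sum decomposition.  On the other hand, the matrices commuting
  with the family are the diagonal ones whose entries are constant along the edges.
\<close>

section \<open>Connectedness of graphs in terms of closed vertex sets\<close>

text \<open>A nonempty set closed under predecessors contains everything that reaches one of its
  points. Conversely, the set of all points that reach \<open>v\<close> is closed and contains
  \<open>v\<close>, so it must be everything.\<close>

lemma rtrancl_total_iff:
  "(\<forall>u v. (u, v) \<in> r\<^sup>*) \<longleftrightarrow> (\<forall>S. r\<inverse> `` S \<subseteq> S \<longrightarrow> S = {} \<or> S = UNIV)"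
proof
  assume total: "\<forall>u v. (u, v) \<in> r\<^sup>*"
  have "u \<in> S" if "r\<inverse> `` S \<subseteq> S" "v \<in> S" for S u v
  proof -
    have "(u, v) \<in> r\<^sup>*"
      using total by blast
    then show ?thesis
      using that by (induction rule: converse_rtrancl_induct) auto
  qed
  then show "\<forall>S. r\<inverse> `` S \<subseteq> S \<longrightarrow> S = {} \<or> S = UNIV"
    by blast
next
  assume closed: "\<forall>S. r\<inverse> `` S \<subseteq> S \<longrightarrow> S = {} \<or> S = UNIV"
  show "\<forall>u v. (u, v) \<in> r\<^sup>*"
  proof (intro allI)
    fix u v
    have "r\<inverse> `` {w. (w, v) \<in> r\<^sup>*} \<subseteq> {w. (w, v) \<in> r\<^sup>*}"
      by (auto intro: converse_rtrancl_into_rtrancl)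
    with closed have "{w. (w, v) \<in> r\<^sup>*} = {} \<or> {w. (w, v) \<in> r\<^sup>*} = UNIV"
      by blast
    then show "(u, v) \<in> r\<^sup>*"
      by blast
  qed
qed

text \<open>The library relation confines paths to the vertex set and demands a nonempty vertex set;
  both conditions are automatic for \<open>UNIV\<close>.\<close>

lemma strongly_connected_UNIV_iff:
  assumes "verts G = UNIV"
  shows "strongly_connected G \<longleftrightarrow> (\<forall>u v. (u, v) \<in> (arcs_ends G)\<^sup>*)"
proof -
  have "rtrancl_on UNIV r = r\<^sup>*" for r :: "'a rel"
    by (auto intro: rtrancl_on_rtranclI rtrancl_consistent_rtrancl_on)
  then show ?thesis
    using assms by (simp add: strongly_connected_def reachable_def)
qed

lemma strongly_connected_matrix_digraph_iff:
  "strongly_connected (matrix_digraph A) \<longleftrightarrow>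
    (\<forall>S. (matrix_supp A)\<inverse> `` S \<subseteq> S \<longrightarrow> S = {} \<or> S = UNIV)"
proof -
  have "arcs_ends (matrix_digraph A) = matrix_supp A"
    by (auto simp: matrix_digraph_def arcs_ends_def arc_to_ends_def)
  moreover have "verts (matrix_digraph A) = UNIV"
    by (simp add: matrix_digraph_def)
  ultimately show ?thesis
    by (simp add: strongly_connected_UNIV_iff rtrancl_total_iff)
qed

lemma weakly_connected_matrix_digraph_iff:
  "weakly_connected (matrix_digraph A) \<longleftrightarrow>
    (\<forall>S. (matrix_supp A)\<inverse> `` S \<subseteq> S \<and> (matrix_supp A)\<inverse> `` (- S) \<subseteq> - S \<longrightarrow> S = {} \<or> S = UNIV)"
proof -
  let ?r = "matrix_supp A"
  have "arcs_ends (with_proj (mk_symmetric (matrix_digraph A))) = ?r \<union> ?r\<inverse>"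
    by (force simp: mk_symmetric_def matrix_digraph_def arcs_ends_def arc_to_ends_def)
  moreover have "verts (with_proj (mk_symmetric (matrix_digraph A))) = UNIV"
    by (simp add: matrix_digraph_def)
  \<comment> \<open>Closure of \<open>S\<close> under successors is closure of \<open>- S\<close>
    under predecessors.\<close>
  moreover have "(?r \<union> ?r\<inverse>)\<inverse> `` S \<subseteq> S \<longleftrightarrow> ?r\<inverse> `` S \<subseteq> S \<and> ?r\<inverse> `` (- S) \<subseteq> - S" for S
    by blast
  ultimately show ?thesis
    by (simp add: connected_def strongly_connected_UNIV_iff rtrancl_total_iff)
qed

section \<open>Subspaces spanned by basis vectors\<close>

text \<open>Over a field this is the span of the vectors \<open>axis i 1\<close> with
  \<open>i \<in> S\<close>; describing it by vanishing coordinates lets membership be checked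
  entrywise.\<close>

definition coordinate_subspace :: "'n set \<Rightarrow> ('a::zero^'n) set" where
  "coordinate_subspace S = {x. \<forall>i. i \<notin> S \<longrightarrow> x $ i = 0}"

lemma axis_in_coordinate_subspace_iff [simp]:
  "axis i (1::'a::zero_neq_one) \<in> coordinate_subspace S \<longleftrightarrow> i \<in> S"
  by (auto simp: coordinate_subspace_def axis_def)

lemma coordinate_subspace_subset_iff [simp]:
  "(coordinate_subspace S :: ('a::zero_neq_one^'n) set) \<subseteq> coordinate_subspace T \<longleftrightarrow> S \<subseteq> T"
proof
  assume *: "(coordinate_subspace S :: ('a^'n) set) \<subseteq> coordinate_subspace T"
  show "S \<subseteq> T"
  proof
    fix i assume "i \<in> S"
    then have "axis i (1::'a) \<in> coordinate_subspace S"
      by simp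
    with * have "axis i (1::'a) \<in> coordinate_subspace T"
      by blast
    then show "i \<in> T"
      by simp
  qed
qed (auto simp: coordinate_subspace_def)

lemma coordinate_subspace_eq_iff [simp]:
  "(coordinate_subspace S :: ('a::zero_neq_one^'n) set) = coordinate_subspace T \<longleftrightarrow> S = T"
  by (simp add: set_eq_subset)

lemma coordinate_subspace_eq_zero_iff [simp]:
  "(coordinate_subspace S :: ('a::zero_neq_one^'n) set) = {0} \<longleftrightarrow> S = {}"
proof -
  have "{0} = (coordinate_subspace {} :: ('a^'n) set)"
    by (auto simp: coordinate_subspace_def vec_eq_iff)
  then show ?thesis
    by simp
qed

lemma coordinate_subspace_eq_UNIV_iff [simp]:
  "(coordinate_subspace S :: ('a::zero_neq_one^'n) set) = UNIV \<longleftrightarrow> S = UNIV"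
proof -
  have "UNIV = (coordinate_subspace UNIV :: ('a^'n) set)"
    by (simp add: coordinate_subspace_def)
  then show ?thesis
    by (metis coordinate_subspace_eq_iff)
qed

lemma coordinate_subspace_Int:
  "coordinate_subspace S \<inter> coordinate_subspace T = coordinate_subspace (S \<inter> T)"
  by (auto simp: coordinate_subspace_def)

lemma coordinate_subspace_sum:
  "{v + w | v w. v \<in> coordinate_subspace S \<and> w \<in> coordinate_subspace T} =
    (coordinate_subspace (S \<union> T) :: ('a::monoid_add^'n) set)"
proof (intro equalityI subsetI)
  fix x :: "'a^'n" assume x: "x \<in> coordinate_subspace (S \<union> T)"
  \<comment> \<open>\<open>S\<close> and \<open>T\<close> may overlap; the common coordinates all go
    to \<open>?v\<close>.\<close>
  let ?v = "\<chi> i. if i \<in> S then x $ i else 0" and ?w = "\<chi> i. if i \<in> S then 0 else x $ i"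
  have "x = ?v + ?w"
    by (simp add: vec_eq_iff)
  moreover have "?v \<in> coordinate_subspace S" "?w \<in> coordinate_subspace T"
    using x by (auto simp: coordinate_subspace_def)
  ultimately show "x \<in> {v + w | v w. v \<in> coordinate_subspace S \<and> w \<in> coordinate_subspace T}"
    by blast
qed (auto simp: coordinate_subspace_def)

lemma subspace_coordinate_subspace: "vec.subspace (coordinate_subspace S)"
  by (auto simp: vec.subspace_def coordinate_subspace_def)

lemma matrix_vector_mult_axis: "(M *v axis j (1::'a::semiring_1)) $ i = M $ i $ j"
  by (simp add: matrix_vector_mult_def axis_def if_distrib cong: if_cong)

text \<open>\<open>M\<close> maps \<open>axis m 1\<close> to its column \<open>m\<close>, whose
  nonzero entries sit at the sources \<open>k\<close> of the arrows into \<open>m\<close>. This is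
  why closure under predecessors appears, and not under successors.\<close>

lemma coordinate_subspace_invariant_iff:
  fixes M :: "'a::field^'n^'n"
  shows "(\<forall>x\<in>coordinate_subspace S. M *v x \<in> coordinate_subspace S) \<longleftrightarrow> (matrix_supp M)\<inverse> `` S \<subseteq> S"
proof
  assume inv: "\<forall>x\<in>coordinate_subspace S. M *v x \<in> coordinate_subspace S"
  have "k \<in> S" if "m \<in> S" "M $ k $ m \<noteq> 0" for k m
  proof (rule ccontr)
    assume "k \<notin> S"
    have "M *v axis m 1 \<in> coordinate_subspace S"
      using inv \<open>m \<in> S\<close> by simp
    then have "(M *v axis m 1) $ k = 0"
      using \<open>k \<notin> S\<close> by (simp add: coordinate_subspace_def)
    then show False
      using that by (simp add: matrix_vector_mult_axis)
  qed
  then show "(matrix_supp M)\<inverse> `` S \<subseteq> S"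
    by (auto simp: matrix_supp_def)
next
  assume closed: "(matrix_supp M)\<inverse> `` S \<subseteq> S"
  have "(M *v x) $ k = 0" if "x \<in> coordinate_subspace S" "k \<notin> S" for x k
  proof -
    \<comment> \<open>For \<open>m \<notin> S\<close> the factor \<open>x $ m\<close> vanishes; for
      \<open>m \<in> S\<close> an arrow from \<open>k\<close> to \<open>m\<close> would put
      \<open>k\<close> into \<open>S\<close>.\<close>
    have "M $ k $ m * x $ m = 0" for m
      using that closed by (cases "m \<in> S") (auto simp: coordinate_subspace_def matrix_supp_def)
    then have "(\<Sum>m\<in>UNIV. M $ k $ m * x $ m) = 0"
      by (intro sum.neutral ballI)
    then show ?thesis
      by (simp add: matrix_vector_mult_def)
  qed
  then show "\<forall>x\<in>coordinate_subspace S. M *v x \<in> coordinate_subspace S"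
    by (simp add: coordinate_subspace_def)
qed

section \<open>Invariant subspaces of a diagonal matrix with distinct eigenvalues\<close>

lemma diag_matrix_mult_vector: "(diag_matrix l *v x) $ i = l i * x $ i"
  for l :: "'n::finite \<Rightarrow> 'a::semiring_1"
  by (simp add: diag_matrix_def matrix_vector_mult_def if_distrib[where f = "\<lambda>y. y * _"] cong: if_cong)

lemma diag_matrix_mult_left: "(diag_matrix l ** B) $ i $ j = l i * B $ i $ j"
  for l :: "'n::finite \<Rightarrow> 'a::semiring_1"
  by (simp add: diag_matrix_def matrix_matrix_mult_def if_distrib[where f = "\<lambda>y. y * _"] cong: if_cong)

lemma diag_matrix_mult_right: "(B ** diag_matrix l) $ i $ j = B $ i $ j * l j"
  for l :: "'n::finite \<Rightarrow> 'a::semiring_1"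
  by (simp add: diag_matrix_def matrix_matrix_mult_def if_distrib cong: if_cong)

lemma coordinate_subspace_diag_matrix:
  fixes l :: "'n::finite \<Rightarrow> 'a::field"
  assumes "x \<in> coordinate_subspace S"
  shows "diag_matrix l *v x \<in> coordinate_subspace S"
  using assms by (simp add: coordinate_subspace_def diag_matrix_mult_vector)

text \<open>
  The product of the matrices \<open>diag_matrix l - mat (l j)\<close> over \<open>j \<noteq> i\<close> annihilates all coordinates
  of a vector except the \<open>i\<close>-th.
\<close>
lemma axis_in_diag_invariant_subspace:
  fixes l :: "'n::finite \<Rightarrow> 'a::field"
  assumes "inj l" "vec.subspace V" and inv: "\<And>x. x \<in> V \<Longrightarrow> diag_matrix l *v x \<in> V"
    and "x \<in> V" "x $ i \<noteq> 0"
  shows "axis i 1 \<in> V"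
proof -
  have prod_in: "(\<chi> k. (\<Prod>j\<in>T. l k - l j) * x $ k) \<in> V" for T
  proof (induction T rule: infinite_finite_induct)
    case (insert t T)
    let ?y = "\<chi> k. (\<Prod>j\<in>T. l k - l j) * x $ k"
    have "(\<chi> k. (\<Prod>j\<in>insert t T. l k - l j) * x $ k) = diag_matrix l *v ?y - l t *s ?y"
      using insert.hyps by (simp add: vec_eq_iff diag_matrix_mult_vector algebra_simps)
    then show ?case
      using insert.IH inv assms(2) by (simp add: vec.subspace_diff vec.subspace_scale)
  \<comment> \<open>For empty or infinite \<open>T\<close> the product is 1 and the vector is
    \<open>x\<close> itself.\<close>
  qed (use \<open>x \<in> V\<close> in simp_all)
  define c where "c = (\<Prod>j\<in>-{i}. l i - l j) * x $ i"
  have "(\<Prod>j\<in>-{i}. l k - l j) = 0" if "k \<noteq> i" for k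
    using that by (auto intro: prod_zero)
  then have "(\<chi> k. (\<Prod>j\<in>-{i}. l k - l j) * x $ k) = c *s axis i 1"
    by (auto simp: vec_eq_iff axis_def c_def)
  then have "c *s axis i 1 \<in> V"
    using prod_in by metis
  then have "inverse c *s (c *s axis i 1) \<in> V"
    using assms(2) by (rule vec.subspace_scale[rotated])
  \<comment> \<open>All factors \<open>l i - l j\<close> are nonzero because the eigenvalues are
    distinct.\<close>
  moreover have "c \<noteq> 0"
    using assms(5) injD[OF assms(1)] by (auto simp: c_def)
  ultimately show ?thesis
    by simp
qed

text \<open>Each nonzero coordinate of a vector of \<open>V\<close> puts the corresponding basis
  vector into \<open>V\<close>; the reverse inclusion is the basis expansion.\<close>

lemma diag_invariant_subspace_eq:
  fixes l :: "'n::finite \<Rightarrow> 'a::field"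
  assumes "inj l" and V: "vec.subspace V" and "\<And>x. x \<in> V \<Longrightarrow> diag_matrix l *v x \<in> V"
  shows "V = coordinate_subspace {i. axis i 1 \<in> V}"
proof (intro equalityI subsetI)
  fix x assume "x \<in> V"
  then show "x \<in> coordinate_subspace {i. axis i 1 \<in> V}"
    using axis_in_diag_invariant_subspace[OF assms] by (auto simp: coordinate_subspace_def)
next
  fix x :: "'a^'n" assume x: "x \<in> coordinate_subspace {i. axis i 1 \<in> V}"
  have "x $ i *s axis i 1 \<in> V" for i
    using x V by (cases "axis i 1 \<in> V")
      (auto simp: coordinate_subspace_def vec.subspace_scale vec.subspace_0)
  then have "(\<Sum>i\<in>UNIV. x $ i *s axis i 1) \<in> V"
    using V by (simp add: vec.subspace_sum)
  then show "x \<in> V"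
    by (simp add: basis_expansion)
qed

text \<open>This turns questions about invariant subspaces into questions about index sets, for
  irreducibility and indecomposability alike.\<close>

lemma invariant_subspace_diag_iff:
  fixes l :: "'n::finite \<Rightarrow> 'a::field"
  assumes "inj l"
  shows "invariant_subspace {diag_matrix l, A} V \<longleftrightarrow>
    (\<exists>S. V = coordinate_subspace S \<and> (matrix_supp A)\<inverse> `` S \<subseteq> S)"
proof
  assume V: "invariant_subspace {diag_matrix l, A} V"
  let ?S = "{i. axis i 1 \<in> V}"
  have "V = coordinate_subspace ?S"
    using V by (intro diag_invariant_subspace_eq[OF assms]) (auto simp: invariant_subspace_def)
  moreover from this have "(matrix_supp A)\<inverse> `` ?S \<subseteq> ?S"
    using V by (simp add: invariant_subspace_def flip: coordinate_subspace_invariant_iff)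
  ultimately show "\<exists>S. V = coordinate_subspace S \<and> (matrix_supp A)\<inverse> `` S \<subseteq> S"
    by blast
next
  assume "\<exists>S. V = coordinate_subspace S \<and> (matrix_supp A)\<inverse> `` S \<subseteq> S"
  then show "invariant_subspace {diag_matrix l, A} V"
    by (auto simp: invariant_subspace_def subspace_coordinate_subspace coordinate_subspace_diag_matrix
        simp flip: coordinate_subspace_invariant_iff)
qed

section \<open>Irreducibility and indecomposability\<close>

lemma irreducible_diag_iff:
  fixes l :: "'n::finite \<Rightarrow> 'a::field"
  assumes "inj l"
  shows "irreducible_family {diag_matrix l, A} \<longleftrightarrow> strongly_connected (matrix_digraph A)"
proof -
  have "irreducible_family {diag_matrix l, A} \<longleftrightarrow> (\<forall>S. (matrix_supp A)\<inverse> `` S \<subseteq> S \<longrightarrow>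
      (coordinate_subspace S :: ('a^'n) set) = {0} \<or> (coordinate_subspace S :: ('a^'n) set) = UNIV)"
    unfolding irreducible_family_def invariant_subspace_diag_iff[OF assms] by blast
  then show ?thesis
    by (simp only: strongly_connected_matrix_digraph_iff coordinate_subspace_eq_zero_iff
        coordinate_subspace_eq_UNIV_iff)
qed

lemma indecomposable_diag_iff:
  fixes l :: "'n::finite \<Rightarrow> 'a::field"
  assumes "inj l"
  shows "indecomposable_family {diag_matrix l, A} \<longleftrightarrow> weakly_connected (matrix_digraph A)"
proof -
  let ?r = "(matrix_supp A)\<inverse>" and ?C = "coordinate_subspace :: 'n set \<Rightarrow> ('a^'n) set"
  have *: "(\<exists>V W. (\<exists>S. V = c S \<and> P S) \<and> (\<exists>T. W = c T \<and> P T) \<and> Q V W) \<longleftrightarrow>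
      (\<exists>S T. P S \<and> P T \<and> Q (c S) (c T))"
    for c :: "'n set \<Rightarrow> ('a^'n) set" and P Q
    by blast
  have "(\<exists>V W. invariant_subspace {diag_matrix l, A} V \<and> invariant_subspace {diag_matrix l, A} W \<and>
      V \<noteq> {0} \<and> W \<noteq> {0} \<and> V \<inter> W = {0} \<and> {v + w | v w. v \<in> V \<and> w \<in> W} = UNIV) \<longleftrightarrow>
    (\<exists>S T. ?r `` S \<subseteq> S \<and> ?r `` T \<subseteq> T \<and> ?C S \<noteq> {0} \<and> ?C T \<noteq> {0} \<and> ?C S \<inter> ?C T = {0} \<and>
      {v + w | v w. v \<in> ?C S \<and> w \<in> ?C T} = UNIV)"
    unfolding invariant_subspace_diag_iff[OF assms] by (rule *)
  also have "\<dots> \<longleftrightarrow>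
    (\<exists>S T. ?r `` S \<subseteq> S \<and> ?r `` T \<subseteq> T \<and> S \<noteq> {} \<and> T \<noteq> {} \<and> S \<inter> T = {} \<and> S \<union> T = UNIV)"
    by (simp add: coordinate_subspace_sum coordinate_subspace_Int)
  \<comment> \<open>Disjoint sets that cover all indices are complementary, so \<open>T\<close> is
    eliminated as \<open>- S\<close>, and \<open>T \<noteq> {}\<close> becomes
    \<open>S \<noteq> UNIV\<close>.\<close>
  also have "\<dots> \<longleftrightarrow> (\<exists>S. ?r `` S \<subseteq> S \<and> ?r `` (- S) \<subseteq> - S \<and> S \<noteq> {} \<and> S \<noteq> UNIV)"
  proof -
    have "S \<inter> T = {} \<and> S \<union> T = UNIV \<longleftrightarrow> T = - S" and "- S = {} \<longleftrightarrow> S = UNIV" for S T :: "'n set"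
      by blast+
    then show ?thesis
      by simp
  qed
  finally have "indecomposable_family {diag_matrix l, A} \<longleftrightarrow>
      \<not> (\<exists>S. ?r `` S \<subseteq> S \<and> ?r `` (- S) \<subseteq> - S \<and> S \<noteq> {} \<and> S \<noteq> UNIV)"
    by (simp only: indecomposable_family_def)
  then show ?thesis
    by (simp only: weakly_connected_matrix_digraph_iff) metis
qed

section \<open>Commuting matrices and Schur irreducibility\<close>

lemma commutes_diag_iff:
  fixes l :: "'n::finite \<Rightarrow> 'a::field"
  assumes "inj l"
  shows "B ** diag_matrix l = diag_matrix l ** B \<longleftrightarrow> (\<exists>b. B = diag_matrix b)"
proof
  assume comm: "B ** diag_matrix l = diag_matrix l ** B"
  have "B $ i $ j = 0" if "i \<noteq> j" for i j
  proof -
    have "B $ i $ j * l j = l i * B $ i $ j"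
      using comm by (metis diag_matrix_mult_left diag_matrix_mult_right)
    then have "B $ i $ j * (l j - l i) = 0"
      by (simp add: algebra_simps)
    then show ?thesis
      using that assms by (simp add: inj_eq)
  qed
  then have "B = diag_matrix (\<lambda>i. B $ i $ i)"
    by (simp add: diag_matrix_def vec_eq_iff)
  then show "\<exists>b. B = diag_matrix b"
    by blast
next
  assume "\<exists>b. B = diag_matrix b"
  then obtain b where "B = diag_matrix b" ..
  then show "B ** diag_matrix l = diag_matrix l ** B"
    by (simp add: vec_eq_iff diag_matrix_mult_left diag_matrix_mult_right)
      (simp add: diag_matrix_def)
qed

text \<open>The entry of the commutator at \<open>(k, m)\<close> is
  \<open>(b k - b m) * A $ k $ m\<close>.\<close>

lemma diag_matrix_commutes_iff:
  fixes b :: "'n::finite \<Rightarrow> 'a::field"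
  shows "diag_matrix b ** A = A ** diag_matrix b \<longleftrightarrow> (\<forall>(k, m)\<in>matrix_supp A. b k = b m)"
  by (auto simp: vec_eq_iff diag_matrix_mult_left diag_matrix_mult_right matrix_supp_def mult.commute)

lemma diag_matrix_eq_mat_iff: "diag_matrix b = mat c \<longleftrightarrow> b = (\<lambda>_. c)"
  by (auto simp: diag_matrix_def mat_def vec_eq_iff fun_eq_iff)

text \<open>Functions constant along the edges correspond to sets closed in both directions: the
  indicator of such a set is such a function, and the level sets of such a function are such
  sets.\<close>

lemma schur_irreducible_diag_iff:
  fixes l :: "'n::finite \<Rightarrow> 'a::field"
  assumes "inj l"
  shows "schur_irreducible_family {diag_matrix l, A} \<longleftrightarrow> weakly_connected (matrix_digraph A)"
proof -
  have "schur_irreducible_family {diag_matrix l, A} \<longleftrightarrow>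
    (\<forall>b :: 'n \<Rightarrow> 'a. (\<forall>(k, m)\<in>matrix_supp A. b k = b m) \<longrightarrow> (\<exists>c. b = (\<lambda>_. c)))"
  proof -
    have "schur_irreducible_family {diag_matrix l, A} \<longleftrightarrow>
      (\<forall>b. diag_matrix b ** A = A ** diag_matrix b \<longrightarrow> (\<exists>c. diag_matrix b = mat c))"
      by (auto simp: schur_irreducible_family_def commutes_diag_iff[OF assms])
    then show ?thesis
      by (simp only: diag_matrix_commutes_iff diag_matrix_eq_mat_iff)
  qed
  also have "\<dots> \<longleftrightarrow> weakly_connected (matrix_digraph A)"
    unfolding weakly_connected_matrix_digraph_iff
  proof (intro iffI allI impI)
    fix S
    assume const: "\<forall>b :: 'n \<Rightarrow> 'a. (\<forall>(k, m)\<in>matrix_supp A. b k = b m) \<longrightarrow> (\<exists>c. b = (\<lambda>_. c))"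
      and S: "(matrix_supp A)\<inverse> `` S \<subseteq> S \<and> (matrix_supp A)\<inverse> `` (- S) \<subseteq> - S"
    \<comment> \<open>No edge joins \<open>S\<close> to its complement, so the indicator of
      \<open>S\<close> is constant along edges.\<close>
    have "\<forall>(k, m)\<in>matrix_supp A. (of_bool (k \<in> S) :: 'a) = of_bool (m \<in> S)"
      using S by auto
    then have "\<exists>c :: 'a. (\<lambda>k. of_bool (k \<in> S)) = (\<lambda>_. c)"
      by (rule const[THEN spec, THEN mp])
    then have "of_bool (k \<in> S) = (of_bool (m \<in> S) :: 'a)" for k m
      by (metis (no_types))
    then have "k \<in> S \<longleftrightarrow> m \<in> S" for k m
      by (simp only: of_bool_eq_iff)
    then show "S = {} \<or> S = UNIV"
      by (metis UNIV_eq_I equals0I)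
  next
    fix b :: "'n \<Rightarrow> 'a"
    assume closed: "\<forall>S. (matrix_supp A)\<inverse> `` S \<subseteq> S \<and> (matrix_supp A)\<inverse> `` (- S) \<subseteq> - S \<longrightarrow>
        S = {} \<or> S = UNIV"
      and b: "\<forall>(k, m)\<in>matrix_supp A. b k = b m"
    \<comment> \<open>The level set of \<open>b\<close> through \<open>i\<close> contains
      \<open>i\<close>, which rules out the first alternative.\<close>
    have "{k. b k = b i} = {} \<or> {k. b k = b i} = UNIV" for i
      using b by (intro closed[rule_format]) auto
    then have "b k = b i" for k i
      by blast
    then have "b = (\<lambda>_. b undefined)"
      by (intro ext)
    then show "\<exists>c. b = (\<lambda>_. c)" ..
  qed
  finally show ?thesis .
qed

theorem theorem13:
  fixes l :: "'n::finite \<Rightarrow> complex" and A :: "complex^'n^'n"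
  assumes "inj l" and "\<And>i. l i \<noteq> 0"
  shows "(irreducible_family {diag_matrix l, A} \<longleftrightarrow> strongly_connected (matrix_digraph A)) \<and>
         (schur_irreducible_family {diag_matrix l, A} \<longleftrightarrow> weakly_connected (matrix_digraph A)) \<and>
         (indecomposable_family {diag_matrix l, A} \<longleftrightarrow> schur_irreducible_family {diag_matrix l, A})"
  \<comment> \<open>The third equivalence holds because both of its sides amount to weak
    connectedness.\<close>
  by (simp add: irreducible_diag_iff[OF assms(1)] indecomposable_diag_iff[OF assms(1)]
      schur_irreducible_diag_iff[OF assms(1)])

end
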